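(* Let $Y$ be a contraction in a Hilbert space $\mathfrak H$ with $\ker(I-Y)=\{0\}$, and let $Y_R=\frac12(Y+Y^* )$. Then: (1) $\operatorname{ran}D_{Y^*}+\operatorname{ran}(I-Y)=\operatorname{ran}D_Y+\operatorname{ran}(I-Y^* )=\operatorname{ran}(I-Y_R)^{1/2}$; therefore $\operatorname{ran}(I-Y)$, $\operatorname{ran}(I-Y^* )$, $\operatorname{ran}D_Y$ and $\operatorname{ran}D_{Y^*}$ are all contained in $\operatorname{ran}(I-Y_R)^{1/2}$. (2) $\operatorname{ran}(I-Y)\cap\operatorname{ran}D_{Y^*}=\{0\}$ if and only if $\operatorname{ran}(I-Y^* )\cap\operatorname{ran}D_Y=\{0\}$. (3) $\operatorname{ran}(I-Y^* )\cap\operatorname{ran}D_Y=(I-Y^* )(I-Y)^{-1}\big(\operatorname{ran}(I-Y)\cap\operatorname{ran}D_{Y^*}\big)$. (4) If $h\in\mathfrak H$ and $D_{Y^*}h\in\operatorname{ran}(I-Y)$, then $$\big\|-Y^*h+D_Y(I-Y)^{-1}D_{Y^*}h\big\|=\|h\|$$ and $$D_Y\big(-Y^*h+D_Y(I-Y)^{-1}D_{Y^*}h\big)\in\operatorname{ran}(I-Y^* ).$$ (5) $\operatorname{ran}D_{Y^*}\subseteq\operatorname{ran}(I-Y)$ if and only if $\operatorname{ran}(I-Y)=\operatorname{ran}(I-Y_R)^{1/2}$. (6) $\operatorname{ran}D_{Y}\subseteq\operatorname{ran}(I-Y^* )$ if and only if $\operatorname{ran}(I-Y^* )=\operatorname{ran}(I-Y_R)^{1/2}$.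 (7) Both inclusions $\operatorname{ran}D_{Y^*}\subseteq\operatorname{ran}(I-Y)$ and $\operatorname{ran}D_Y\subseteq\operatorname{ran}(I-Y^* )$ hold if and only if $\operatorname{ran}(I-Y^* )=\operatorname{ran}(I-Y)=\operatorname{ran}(I-Y_R)^{1/2}$. (8) $\operatorname{ran}D_Y^2\subset\operatorname{ran}(I-Y^* )$ if and only if $\operatorname{ran}(I-Y)\subseteq\operatorname{ran}(I-Y^* )$.
   Context: For a contraction $Z$, $D_Z=(I-Z^*Z)^{1/2}$ is its defect operator. $(I-Y)^{-1}$ denotes the (possibly unbounded) inverse defined on $\operatorname{ran}(I-Y)$. Inclusions are not assumed strict. *)

theory Defs
  imports "HOL-Analysis.Analysis"
begin

section \<open>Complex Hilbert spaces\<close>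

text \<open>
  A complex inner product space is presented on top of its underlying real inner product space,
  whose inner product is the real part of the complex one; norm, topology and completeness
  are therefore the ones already provided by \<^class>\<open>real_inner\<close> and \<^class>\<open>complete_space\<close>, and
  positive definiteness of \<open>cinner\<close> is inherited from \<^class>\<open>real_inner\<close>.
  The form is linear in the first argument.
\<close>

class complex_inner = real_inner +
  fixes scaleC :: "complex \<Rightarrow> 'a \<Rightarrow> 'a" (infixr \<open>*\<^sub>C\<close> 75)
    and cinner :: "'a \<Rightarrow> 'a \<Rightarrow> complex"
  assumes scaleC_of_real: "complex_of_real r *\<^sub>C x = r *\<^sub>R x"
    and scaleC_add_right: "c *\<^sub>C (x + y) = c *\<^sub>C x + c *\<^sub>C y"
    and scaleC_add_left: "(c + d) *\<^sub>C x = c *\<^sub>C x + d *\<^sub>C x"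
    and scaleC_scaleC: "c *\<^sub>C d *\<^sub>C x = (c * d) *\<^sub>C x"
    and cinner_add_left: "cinner (x + y) z = cinner x z + cinner y z"
    and cinner_scaleC_left: "cinner (c *\<^sub>C x) y = c * cinner x y"
    and cinner_commute: "cinner x y = cnj (cinner y x)"
    and Re_cinner: "Re (cinner x y) = inner x y"

class chilbert_space = complex_inner + complete_space

instantiation complex :: chilbert_space
begin

definition scaleC_complex :: "complex \<Rightarrow> complex \<Rightarrow> complex"
  where "scaleC_complex c x = c * x"

definition cinner_complex :: "complex \<Rightarrow> complex \<Rightarrow> complex"
  where "cinner_complex x y = x * cnj y"

instance
  by standard
    (simp_all add: scaleC_complex_def cinner_complex_def scaleR_conv_of_real inner_complex_def
      algebra_simps)

end

section \<open>Bounded operators\<close>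

definition bounded_clinear :: "('a::complex_inner \<Rightarrow> 'b::complex_inner) \<Rightarrow> bool"
  where "bounded_clinear A \<longleftrightarrow> bounded_linear A \<and> (\<forall>c x. A (c *\<^sub>C x) = c *\<^sub>C A x)"

definition contraction :: "('a::complex_inner \<Rightarrow> 'b::complex_inner) \<Rightarrow> bool"
  where "contraction A \<longleftrightarrow> bounded_clinear A \<and> (\<forall>x. norm (A x) \<le> norm x)"

definition cadjoint :: "('a::chilbert_space \<Rightarrow> 'b::chilbert_space) \<Rightarrow> 'b \<Rightarrow> 'a"
  where "cadjoint A = (THE B. \<forall>x y. cinner (A x) y = cinner x (B y))"

definition positive_op :: "('a::chilbert_space \<Rightarrow> 'a) \<Rightarrow> bool"
  where "positive_op A \<longleftrightarrow> bounded_clinear A \<and> (\<forall>x. cinner (A x) x \<in> \<real>\<^sub>\<ge>\<^sub>0)"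

text \<open>The unique positive square root; meaningful only for positive \<open>A\<close>.\<close>

definition sqrt_op :: "('a::chilbert_space \<Rightarrow> 'a) \<Rightarrow> 'a \<Rightarrow> 'a"
  where "sqrt_op A = (THE B. positive_op B \<and> B \<circ> B = A)"

definition defect :: "('a::chilbert_space \<Rightarrow> 'b::chilbert_space) \<Rightarrow> 'a \<Rightarrow> 'a"
  where "defect Z = sqrt_op (id - (cadjoint Z \<circ> Z))"

definition real_part_op :: "('a::chilbert_space \<Rightarrow> 'a) \<Rightarrow> 'a \<Rightarrow> 'a"
  where "real_part_op Y = (\<lambda>x. (1/2) *\<^sub>R (Y x + cadjoint Y x))"

end

theory Submission imports Defs begin

text \<open>
  Since \<open>D\<^sub>Y\<^sub>*\<^sup>2 + (I - Y)(I - Y*) = 2 (I - Y\<^sub>R)\<close>, the identities in (1) are instances of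
  \<open>ran A + ran B = ran (AA* + BB*)\<^sup>1\<^sup>/\<^sup>2\<close>, and (5)--(7) follow from (1) because ranges are subspaces.
  If \<open>D\<^sub>Y\<^sub>* h = (I - Y) f\<close>, then the intertwining \<open>D\<^sub>Y Y* = Y* D\<^sub>Y\<^sub>*\<close> shows that
  \<open>g = - Y* h + D\<^sub>Y f\<close> satisfies \<open>D\<^sub>Y g = (I - Y*) f\<close> and \<open>\<parallel>g\<parallel> = \<parallel>h\<parallel>\<close>; together with the same
  argument for \<open>Y*\<close> this gives (2)--(4). Finally, (8) is read off
  \<open>D\<^sub>Y\<^sup>2 = (I - Y*) Y + (I - Y)\<close>.
\<close>

section \<open>Factorization of functionals\<close>

text \<open>Near t = 0 the linear term dominates, so a nonzero a would give a negative value at a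
  small t of the opposite sign.\<close>

lemma quadratic_nonneg_imp_linear_zero:
  fixes a b :: real
  assumes "\<And>t. 0 \<le> 2 * t * a + t\<^sup>2 * b"
  shows "a = 0"
proof (rule ccontr)
  assume "a \<noteq> 0"
  \<comment> \<open>At t = - s a the expression equals s a^2 (s b - 2), so s only has to be positive
    with s b < 2.\<close>
  define s where "s = 1 / (\<bar>b\<bar> + 1)"
  have s: "0 < s" "s * b \<le> 1"
    by (auto simp: s_def field_simps)
  have "0 \<le> 2 * (- (s * a)) * a + (- (s * a))\<^sup>2 * b"
    by (rule assms)
  also have "\<dots> = s * a\<^sup>2 * (s * b - 2)"
    by (simp add: power2_eq_square algebra_simps)
  also have "\<dots> < 0"
    using s \<open>a \<noteq> 0\<close> by (intro mult_pos_neg) auto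
  finally show False by simp
qed

text \<open>Common core of the Riesz and Douglas theorems: with S the identity it is Riesz
  representation; for general S it turns a bound by \<open>norm (S x)\<close> into a factorization
  through S.\<close>

lemma functional_factorization:
  fixes f :: "'a::real_vector \<Rightarrow> real" and S :: "'a \<Rightarrow> 'b::{real_inner,complete_space}"
  assumes f: "linear f" and S: "linear S" and bound: "\<And>x. \<bar>f x\<bar> \<le> c * norm (S x)"
  shows "\<exists>w. \<forall>x. f x = inner (S x) w"
proof -
  \<comment> \<open>The vector \<open>w\<close> is the limit of \<open>S x\<close> along a minimizing sequence of \<open>J\<close>.\<close>
  define J where "J x = (norm (S x))\<^sup>2 - 2 * f x" for x
  define m where "m = Inf (range J)"
  \<comment> \<open>With r = \<open>norm (S x)\<close>, the bound on f gives \<open>J x\<close> at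
    least r^2 - 2 c r; completing the square yields - c^2.\<close>
  have lower: "- c\<^sup>2 \<le> J x" for x
  proof -
    have "0 \<le> (norm (S x) - c)\<^sup>2" by simp
    then show ?thesis
      using bound[of x] by (simp add: J_def power2_diff abs_le_iff algebra_simps)
  qed
  have bdd: "bdd_below (range J)"
    using lower by (meson bdd_belowI2)
  have m_le: "m \<le> J x" for x
    unfolding m_def by (rule cInf_lower[OF _ bdd]) simp
  define e :: "nat \<Rightarrow> real" where "e n = inverse (real (Suc n))" for n
  have e_pos: "e n > 0" for n by (simp add: e_def)
  have e_lim: "e \<longlonglongrightarrow> 0" unfolding e_def by (rule LIMSEQ_inverse_real_of_nat)
  have "\<exists>x. J x < m + e n" for n
    using cInf_lessD[of "range J" "m + e n"] e_pos[of n] by (auto simp: m_def)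
  then obtain X where X: "\<And>n. J (X n) < m + e n" by metis
  \<comment> \<open>Parallelogram law: the terms in f cancel, and J at the midpoint is at least
    m.\<close>
  have gap: "(norm (S (X i) - S (X j)))\<^sup>2 \<le> 2 * (e i + e j)" for i j
  proof -
    have "(norm (S (X i) - S (X j)))\<^sup>2
        = 2 * J (X i) + 2 * J (X j) - 4 * J ((1/2) *\<^sub>R (X i + X j))"
      unfolding J_def by (simp add: linear_add[OF S] linear_scale[OF S] linear_add[OF f]
          linear_scale[OF f] power2_norm_eq_inner inner_simps inner_commute algebra_simps)
    also have "\<dots> \<le> 2 * (e i + e j)"
      using X[of i] X[of j] m_le[of "(1/2) *\<^sub>R (X i + X j)"] by argo
    finally show ?thesis .
  qed
  have "Cauchy (\<lambda>n. S (X n))"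
  proof (rule metric_CauchyI)
    fix \<epsilon> :: real assume "\<epsilon> > 0"
    then have "eventually (\<lambda>n. e n < \<epsilon>\<^sup>2 / 4) sequentially"
      using order_tendstoD(2)[OF e_lim, of "\<epsilon>\<^sup>2 / 4"] by simp
    then obtain N where N: "\<And>n. n \<ge> N \<Longrightarrow> e n < \<epsilon>\<^sup>2 / 4"
      unfolding eventually_sequentially by blast
    have "dist (S (X i)) (S (X j)) < \<epsilon>" if "i \<ge> N" "j \<ge> N" for i j
    proof -
      have "(norm (S (X i) - S (X j)))\<^sup>2 < \<epsilon>\<^sup>2"
        using gap[of i j] N[OF that(1)] N[OF that(2)] by argo
      then show ?thesis
        using \<open>\<epsilon> > 0\<close> by (simp add: dist_norm power2_less_imp_less)
    qed
    then show "\<exists>M. \<forall>i\<ge>M. \<forall>j\<ge>M. dist (S (X i)) (S (X j)) < \<epsilon>" by blast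
  qed
  then obtain w where w: "(\<lambda>n. S (X n)) \<longlonglongrightarrow> w"
    using Cauchy_convergent_iff convergent_def by blast
  \<comment> \<open>The infimum need not be attained, so the first-order condition is tested along
    the sequence: moving from \<open>X n\<close> by \<open>t *\<^sub>R y\<close> lowers J by at most
    \<open>e n\<close>, which tends to 0.\<close>
  have "inner (S y) w - f y = 0" for y
  proof (rule quadratic_nonneg_imp_linear_zero[where b = "(norm (S y))\<^sup>2"])
    fix t :: real
    have "- e n \<le> 2 * t * (inner (S y) (S (X n)) - f y) + t\<^sup>2 * (norm (S y))\<^sup>2" for n
    proof -
      have "J (X n + t *\<^sub>R y)
          = J (X n) + (2 * t * (inner (S y) (S (X n)) - f y) + t\<^sup>2 * (norm (S y))\<^sup>2)"
        unfolding J_def by (simp add: linear_add[OF S] linear_scale[OF S] linear_add[OF f]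
            linear_scale[OF f] power2_norm_eq_inner inner_simps inner_commute algebra_simps)
          (simp add: power2_eq_square)
      then show ?thesis using m_le[of "X n + t *\<^sub>R y"] X[of n] by linarith
    qed
    moreover have "(\<lambda>n. 2 * t * (inner (S y) (S (X n)) - f y) + t\<^sup>2 * (norm (S y))\<^sup>2)
        \<longlonglongrightarrow> 2 * t * (inner (S y) w - f y) + t\<^sup>2 * (norm (S y))\<^sup>2"
      by (intro tendsto_intros w)
    moreover have "(\<lambda>n. - e n) \<longlonglongrightarrow> 0" using tendsto_minus[OF e_lim] by simp
    ultimately show "0 \<le> 2 * t * (inner (S y) w - f y) + t\<^sup>2 * (norm (S y))\<^sup>2"
      by (meson LIMSEQ_le)
  qed
  then show ?thesis by (metis eq_iff_diff_eq_0)
qed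

text \<open>Douglas' criterion for T x = (A' x, B' x), whose adjoint is (u, v) -> A u + B v: z lies
  in the range of that adjoint exactly when |<x, z>| is bounded by a multiple of ||T x||. The norm
  identity makes this the same criterion as for the self-adjoint S.\<close>

lemma range_sum_eq:
  fixes A :: "'a::{real_inner,complete_space} \<Rightarrow> 'c::{real_inner,complete_space}"
    and B :: "'b::{real_inner,complete_space} \<Rightarrow> 'c"
    and S :: "'c \<Rightarrow> 'c"
  assumes lin: "linear A'" "linear B'" "linear S"
    and A: "\<And>x y. inner (A' x) y = inner x (A y)"
    and B: "\<And>x y. inner (B' x) y = inner x (B y)"
    and S: "\<And>x y. inner (S x) y = inner x (S y)"
    and norms: "\<And>x. (norm (A' x))\<^sup>2 + (norm (B' x))\<^sup>2 = k * (norm (S x))\<^sup>2" and "k > 0"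
  shows "range A + range B = range S"
proof
  have normpair: "norm (A' x, B' x) = sqrt k * norm (S x)" for x
    by (simp add: norm_Pair norms real_sqrt_mult)
  show "range A + range B \<subseteq> range S"
  proof
    fix z assume "z \<in> range A + range B"
    then obtain u v where z: "z = A u + B v" by (auto simp: set_plus_def)
    have "\<bar>inner x z\<bar> \<le> (norm (u, v) * sqrt k) * norm (S x)" for x
    proof -
      have "inner x z = inner (A' x, B' x) (u, v)"
        by (simp add: z inner_add_right A B)
      then show ?thesis
        using Cauchy_Schwarz_ineq2[of "(A' x, B' x)" "(u, v)"]
        by (simp add: normpair mult_ac)
    qed
    then obtain w where "\<And>x. inner x z = inner (S x) w"
      using functional_factorization[of "\<lambda>x. inner x z" S] lin(3)
        bounded_linear.linear[OF bounded_linear_inner_left] by blast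
    then have "\<And>x. inner x z = inner x (S w)" by (simp add: S)
    then show "z \<in> range S" by (metis inner_commute rangeI vector_eq_ldot)
  qed
  show "range S \<subseteq> range A + range B"
  proof
    fix z assume "z \<in> range S"
    then obtain w where z: "z = S w" by blast
    have "\<bar>inner x z\<bar> \<le> (norm w / sqrt k) * norm (A' x, B' x)" for x
      using Cauchy_Schwarz_ineq2[of "S x" w] \<open>k > 0\<close>
      by (simp add: z S[symmetric] normpair mult_ac)
    moreover have "linear (\<lambda>x. (A' x, B' x))"
      using lin by (intro linearI) (simp_all add: linear_add linear_scale)
    \<comment> \<open>The factorization takes place in the product Hilbert space; the components of
      p are the arguments of A and B.\<close>
    ultimately obtain p where p: "\<And>x. inner x z = inner (A' x, B' x) p"
      using functional_factorization[of "\<lambda>x. inner x z" "\<lambda>x. (A' x, B' x)"]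
        bounded_linear.linear[OF bounded_linear_inner_left] by blast
    have "inner x z = inner x (A (fst p) + B (snd p))" for x
      by (cases p) (simp add: p A B inner_add_right)
    then have "z = A (fst p) + B (snd p)" by (metis inner_commute vector_eq_ldot)
    then show "z \<in> range A + range B" by (auto simp: set_plus_def)
  qed
qed

section \<open>Square roots\<close>

text \<open>
  A fixed point \<open>X\<close> of \<open>X \<mapsto> (T + X\<^sup>2) / 2\<close> satisfies \<open>(I - X)\<^sup>2 = I - T\<close>. For \<open>\<parallel>T\<parallel> \<le> 1\<close> the
  iterates from \<open>0\<close>, and their increments, are dominated by those of the scalar iteration with
  \<open>T = 1\<close>, which increases to \<open>1\<close>.
\<close>

primrec sqrt_iter :: "('a::real_normed_vector \<Rightarrow>\<^sub>L 'a) \<Rightarrow> nat \<Rightarrow> ('a \<Rightarrow>\<^sub>L 'a)"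
  where "sqrt_iter T 0 = 0"
  | "sqrt_iter T (Suc n) = (1/2) *\<^sub>R (T + (sqrt_iter T n o\<^sub>L sqrt_iter T n))"

primrec sqrt_iter_real :: "nat \<Rightarrow> real"
  where "sqrt_iter_real 0 = 0"
  | "sqrt_iter_real (Suc n) = (1 + (sqrt_iter_real n)\<^sup>2) / 2"

lemma sqrt_iter_real_bounds: "0 \<le> sqrt_iter_real n \<and> sqrt_iter_real n \<le> 1"
  by (induction n) (auto simp: power_le_one)

lemma sqrt_iter_real_le_Suc: "sqrt_iter_real n \<le> sqrt_iter_real (Suc n)"
  using zero_le_power2[of "sqrt_iter_real n - 1"] by (simp add: power2_eq_square algebra_simps)

lemma norm_sqrt_iter_le:
  assumes "norm T \<le> 1"
  shows "norm (sqrt_iter T n) \<le> sqrt_iter_real n"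
proof (induction n)
  case (Suc n)
  have "norm (sqrt_iter T n o\<^sub>L sqrt_iter T n) \<le> norm (sqrt_iter T n) * norm (sqrt_iter T n)"
    by (rule norm_blinfun_compose)
  also have "\<dots> \<le> (sqrt_iter_real n)\<^sup>2"
    using Suc sqrt_iter_real_bounds[of n] by (simp add: power2_eq_square mult_mono)
  finally show ?case
    using assms norm_triangle_ineq[of T "sqrt_iter T n o\<^sub>L sqrt_iter T n"] by simp
qed simp

lemma norm_sqrt_iter_diff_le:
  assumes "norm T \<le> 1"
  shows "norm (sqrt_iter T (Suc n) - sqrt_iter T n) \<le> sqrt_iter_real (Suc n) - sqrt_iter_real n"
proof (induction n)
  case 0
  show ?case using assms by simp
next
  case (Suc n)
  let ?X = "sqrt_iter T n" and ?X' = "sqrt_iter T (Suc n)"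
  let ?r = "sqrt_iter_real n" and ?r' = "sqrt_iter_real (Suc n)"
  have "sqrt_iter T (Suc (Suc n)) - ?X'
      = (1/2) *\<^sub>R ((T + (?X' o\<^sub>L ?X')) - (T + (?X o\<^sub>L ?X)))"
    by (simp only: sqrt_iter.simps(2) scaleR_diff_right)
  \<comment> \<open>Noncommutative form of the difference of squares.\<close>
  also have "\<dots> = (1/2) *\<^sub>R ((?X' o\<^sub>L (?X' - ?X)) + ((?X' - ?X) o\<^sub>L ?X))"
    by (simp only: bounded_bilinear.diff_left[OF bounded_bilinear_blinfun_compose]
        bounded_bilinear.diff_right[OF bounded_bilinear_blinfun_compose]) (simp only: algebra_simps)
  finally have eq: "norm (sqrt_iter T (Suc (Suc n)) - ?X')
      = norm ((?X' o\<^sub>L (?X' - ?X)) + ((?X' - ?X) o\<^sub>L ?X)) / 2"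
    by (simp only: norm_scaleR)
  have "norm (?X' o\<^sub>L (?X' - ?X)) \<le> ?r' * (?r' - ?r)"
    by (rule order_trans[OF norm_blinfun_compose mult_mono])
      (use Suc norm_sqrt_iter_le[OF assms] sqrt_iter_real_bounds in
        \<open>auto simp del: sqrt_iter.simps sqrt_iter_real.simps\<close>)
  moreover have "norm ((?X' - ?X) o\<^sub>L ?X) \<le> (?r' - ?r) * ?r"
    by (rule order_trans[OF norm_blinfun_compose mult_mono])
      (use Suc norm_sqrt_iter_le[OF assms] sqrt_iter_real_bounds sqrt_iter_real_le_Suc in
        \<open>auto simp del: sqrt_iter.simps sqrt_iter_real.simps\<close>)
  ultimately have "norm (sqrt_iter T (Suc (Suc n)) - ?X') \<le> (?r' * (?r' - ?r) + (?r' - ?r) * ?r) / 2"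
    unfolding eq by (intro divide_right_mono order_trans[OF norm_triangle_ineq add_mono]) auto
  \<comment> \<open>For the scalar iteration the difference of squares gives the next increment
    exactly, which closes the induction.\<close>
  also have "\<dots> = sqrt_iter_real (Suc (Suc n)) - ?r'"
  proof -
    have "(a * (a - b) + (a - b) * b) / 2 = (1 + a\<^sup>2) / 2 - a" if "a = (1 + b\<^sup>2) / 2" for a b :: real
    proof -
      have "a * (a - b) + (a - b) * b = a\<^sup>2 - b\<^sup>2" by (simp add: power2_eq_square algebra_simps)
      then show ?thesis using that by argo
    qed
    then show ?thesis by (metis sqrt_iter_real.simps(2))
  qed
  finally show ?case .
qed

lemma convergent_sqrt_iter_real: "convergent sqrt_iter_real"
proof -
  have "incseq sqrt_iter_real" by (intro incseq_SucI sqrt_iter_real_le_Suc)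
  moreover have "\<And>n. sqrt_iter_real n \<le> 1" using sqrt_iter_real_bounds by blast
  ultimately show ?thesis
    using incseq_convergent[of sqrt_iter_real 1] unfolding convergent_def by blast
qed

text \<open>The increments are dominated by those of the convergent scalar sequence, so their series
  converges, and its partial sums telescope to the iterates.\<close>

lemma convergent_sqrt_iter:
  fixes T :: "'a::banach \<Rightarrow>\<^sub>L 'a"
  assumes "norm T \<le> 1"
  shows "convergent (sqrt_iter T)"
proof -
  have "summable (\<lambda>n. sqrt_iter_real (Suc n) - sqrt_iter_real n)"
    using convergent_sqrt_iter_real by (auto simp: convergent_def simp del: sqrt_iter_real.simps intro: telescope_summable)
  then have "summable (\<lambda>n. sqrt_iter T (Suc n) - sqrt_iter T n)"
    using norm_sqrt_iter_diff_le[OF assms] by (rule summable_comparison_test'[where N = 0])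
  then show ?thesis
    unfolding summable_iff_convergent sum_lessThan_telescope by simp
qed

text \<open>T is a bounded-operator object so that the iterates converge in operator norm; the
  result is a plain function because \<open>sqrt_op\<close> ranges over functions.\<close>

definition sqrt_one_minus :: "('a::banach \<Rightarrow>\<^sub>L 'a) \<Rightarrow> 'a \<Rightarrow> 'a"
  where "sqrt_one_minus T x = x - blinfun_apply (lim (sqrt_iter T)) x"

lemma tendsto_sqrt_iter:
  fixes T :: "'a::banach \<Rightarrow>\<^sub>L 'a"
  assumes "norm T \<le> 1"
  shows "sqrt_iter T \<longlonglongrightarrow> lim (sqrt_iter T)"
  using convergent_sqrt_iter[OF assms] by (simp add: convergent_LIMSEQ_iff)

lemma tendsto_sqrt_iter_apply:
  fixes T :: "'a::banach \<Rightarrow>\<^sub>L 'a"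
  assumes "norm T \<le> 1"
  shows "(\<lambda>n. blinfun_apply (sqrt_iter T n) x) \<longlonglongrightarrow> blinfun_apply (lim (sqrt_iter T)) x"
  by (intro blinfun.tendsto tendsto_sqrt_iter assms tendsto_const)

lemma bounded_linear_sqrt_one_minus: "bounded_linear (sqrt_one_minus T)"
  unfolding sqrt_one_minus_def[abs_def]
  by (intro bounded_linear_sub bounded_linear_ident blinfun.bounded_linear_right)

lemma sqrt_one_minus_squared:
  fixes T :: "'a::banach \<Rightarrow>\<^sub>L 'a"
  assumes "norm T \<le> 1"
  shows "sqrt_one_minus T (sqrt_one_minus T x) = x - blinfun_apply T x"
proof -
  let ?X = "lim (sqrt_iter T)"
  have "(\<lambda>n. sqrt_iter T (Suc n)) \<longlonglongrightarrow> (1/2) *\<^sub>R (T + (?X o\<^sub>L ?X))"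
    unfolding sqrt_iter.simps
    by (intro tendsto_intros bounded_bilinear.tendsto[OF bounded_bilinear_blinfun_compose]
        tendsto_sqrt_iter assms)
  then have "?X = (1/2) *\<^sub>R (T + (?X o\<^sub>L ?X))"
    using LIMSEQ_unique LIMSEQ_Suc[OF tendsto_sqrt_iter[OF assms]] by blast
  then have "2 *\<^sub>R blinfun_apply ?X x
      = 2 *\<^sub>R blinfun_apply ((1/2) *\<^sub>R (T + (?X o\<^sub>L ?X))) x" by simp
  also have "\<dots> = blinfun_apply T x + blinfun_apply ?X (blinfun_apply ?X x)"
    by (simp add: blinfun.add_left blinfun.scaleR_left)
  finally have "2 *\<^sub>R blinfun_apply ?X x
      = blinfun_apply T x + blinfun_apply ?X (blinfun_apply ?X x)" .
  then show ?thesis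
    by (simp add: sqrt_one_minus_def blinfun.diff_right scaleR_2 algebra_simps)
qed

text \<open>Every iterate is a polynomial in T with real coefficients, so Z T = T' Z passes to the
  iterates and to their limits. Later Z is multiplication by the imaginary unit, another square
  root, or Y itself.\<close>

lemma sqrt_one_minus_intertwine:
  fixes T :: "'a::banach \<Rightarrow>\<^sub>L 'a" and T' :: "'b::banach \<Rightarrow>\<^sub>L 'b"
  assumes T: "norm T \<le> 1" and T': "norm T' \<le> 1" and Z: "bounded_linear Z"
    and comm: "\<And>x. Z (blinfun_apply T x) = blinfun_apply T' (Z x)"
  shows "Z (sqrt_one_minus T x) = sqrt_one_minus T' (Z x)"
proof -
  have "Z (blinfun_apply (sqrt_iter T n) x) = blinfun_apply (sqrt_iter T' n) (Z x)" for n x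
    by (induction n arbitrary: x)
      (simp_all add: blinfun.add_left blinfun.scaleR_left comm linear_simps[OF Z])
  moreover have "(\<lambda>n. Z (blinfun_apply (sqrt_iter T n) x))
      \<longlonglongrightarrow> Z (blinfun_apply (lim (sqrt_iter T)) x)"
    by (intro bounded_linear.tendsto[OF Z] tendsto_sqrt_iter_apply T)
  ultimately have "Z (blinfun_apply (lim (sqrt_iter T)) x)
      = blinfun_apply (lim (sqrt_iter T')) (Z x)"
    using tendsto_sqrt_iter_apply[OF T', of "Z x"] by (simp add: LIMSEQ_unique)
  then show ?thesis by (simp add: sqrt_one_minus_def linear_simps[OF Z])
qed

text \<open>The iterates have norm at most 1, hence so does their limit X, and <X x, x> cannot
  exceed <x, x>.\<close>

lemma inner_sqrt_one_minus_nonneg: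
  fixes T :: "'a::{real_inner,banach} \<Rightarrow>\<^sub>L 'a"
  assumes "norm T \<le> 1"
  shows "0 \<le> inner (sqrt_one_minus T x) x"
proof -
  let ?X = "lim (sqrt_iter T)"
  have "norm ?X \<le> 1"
  proof (rule Lim_norm_ubound[OF _ tendsto_sqrt_iter[OF assms]])
    show "eventually (\<lambda>n. norm (sqrt_iter T n) \<le> 1) sequentially"
      using norm_sqrt_iter_le[OF assms] sqrt_iter_real_bounds by (blast intro: order_trans always_eventually)
  qed simp
  then have "norm (blinfun_apply ?X x) \<le> norm x"
    using norm_blinfun[of ?X x] mult_right_mono[of "norm ?X" 1 "norm x"] by simp
  then have "inner (blinfun_apply ?X x) x \<le> norm x * norm x"
    using norm_cauchy_schwarz[of "blinfun_apply ?X x" x]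
      mult_right_mono[of "norm (blinfun_apply ?X x)" "norm x" "norm x"] by simp
  then show ?thesis
    by (simp add: sqrt_one_minus_def inner_diff_left dot_square_norm power2_eq_square)
qed

lemma inner_sqrt_one_minus_commute:
  fixes T :: "'a::{real_inner,banach} \<Rightarrow>\<^sub>L 'a"
  assumes T: "norm T \<le> 1"
    and sym: "\<And>x y. inner (blinfun_apply T x) y = inner x (blinfun_apply T y)"
  shows "inner (sqrt_one_minus T x) y = inner x (sqrt_one_minus T y)"
proof -
  have "inner (blinfun_apply (sqrt_iter T n) x) y = inner x (blinfun_apply (sqrt_iter T n) y)"
    for n x y
    by (induction n arbitrary: x y)
      (simp_all add: blinfun.add_left blinfun.scaleR_left inner_simps sym)
  moreover have "(\<lambda>n. inner (blinfun_apply (sqrt_iter T n) x) y)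
      \<longlonglongrightarrow> inner (blinfun_apply (lim (sqrt_iter T)) x) y"
    by (intro tendsto_intros tendsto_sqrt_iter_apply T)
  moreover have "(\<lambda>n. inner x (blinfun_apply (sqrt_iter T n) y))
      \<longlonglongrightarrow> inner x (blinfun_apply (lim (sqrt_iter T)) y)"
    by (intro tendsto_intros tendsto_sqrt_iter_apply T)
  ultimately have "inner (blinfun_apply (lim (sqrt_iter T)) x) y
      = inner x (blinfun_apply (lim (sqrt_iter T)) y)"
    by (simp add: LIMSEQ_unique)
  then show ?thesis by (simp add: sqrt_one_minus_def inner_simps)
qed

section \<open>Adjoints and positive square roots on complex Hilbert spaces\<close>

subclass (in chilbert_space) banach ..

text \<open>Lets adjoints, symmetry and positivity be handled with the real form
  \<open>inner\<close> and multiplication by the imaginary unit.\<close>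

lemma cinner_eq: "cinner x y = Complex (inner x y) (- inner (\<i> *\<^sub>C x) y)"
proof -
  have "inner (\<i> *\<^sub>C x) y = - Im (cinner x y)"
    by (simp add: Re_cinner[symmetric] cinner_scaleC_left)
  then show ?thesis by (simp add: complex_eq_iff Re_cinner)
qed

lemma inner_imaginary_left: "inner (\<i> *\<^sub>C x) y = - inner x (\<i> *\<^sub>C y)"
proof -
  have "Im (cinner x y) = - Im (cinner y x)"
    by (subst cinner_commute) simp
  then have "inner (\<i> *\<^sub>C x) y = - inner (\<i> *\<^sub>C y) x" by (simp add: cinner_eq)
  then show ?thesis by (simp add: inner_commute)
qed

lemma imaginary_imaginary: "\<i> *\<^sub>C \<i> *\<^sub>C x = - (x :: 'a::complex_inner)"
  using scaleC_of_real[of "-1" x] by (simp add: scaleC_scaleC)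

lemma scaleC_conv: "c *\<^sub>C x = Re c *\<^sub>R x + Im c *\<^sub>R (\<i> *\<^sub>C x)"
proof -
  have "c = complex_of_real (Re c) + complex_of_real (Im c) * \<i>"
    by (simp add: complex_eq_iff)
  then have "c *\<^sub>C x = (complex_of_real (Re c) + complex_of_real (Im c) * \<i>) *\<^sub>C x" by simp
  then show ?thesis
    by (simp only: scaleC_add_left scaleC_scaleC[symmetric] scaleC_of_real)
qed

lemma norm_imaginary: "norm (\<i> *\<^sub>C x) = norm x"
  by (simp add: norm_eq_sqrt_inner inner_imaginary_left imaginary_imaginary)

lemma bounded_linear_imaginary: "bounded_linear (\<lambda>x. \<i> *\<^sub>C x :: 'a::complex_inner)"
proof (rule bounded_linear_intro[where K = 1])
  show "\<i> *\<^sub>C r *\<^sub>R x = r *\<^sub>R (\<i> *\<^sub>C x)" for r and x :: 'a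
    by (simp add: scaleC_of_real[symmetric] scaleC_scaleC mult.commute)
qed (simp_all add: scaleC_add_right norm_imaginary)

text \<open>Splitting c into real and imaginary parts reduces complex homogeneity to commuting with
  the imaginary unit.\<close>

lemma bounded_clinearI:
  assumes "bounded_linear A" "\<And>x. A (\<i> *\<^sub>C x) = \<i> *\<^sub>C A x"
  shows "bounded_clinear A"
  unfolding bounded_clinear_def
proof (intro conjI allI)
  show "A (c *\<^sub>C x) = c *\<^sub>C A x" for c x
    by (subst (1 2) scaleC_conv) (simp add: linear_simps[OF assms(1)] assms(2))
qed (rule assms(1))

section \<open>Adjoints\<close>

lemma cinner_adjointI:
  assumes "bounded_clinear A" "\<And>x y. inner (A x) y = inner x (B y)"
  shows "cinner (A x) y = cinner x (B y)"
proof -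
  have "\<i> *\<^sub>C A x = A (\<i> *\<^sub>C x)" using assms(1) by (simp add: bounded_clinear_def)
  then show ?thesis by (simp add: cinner_eq assms(2))
qed

lemma cadjoint_eqI:
  assumes "bounded_clinear A" "\<And>x y. inner (A x) y = inner x (B y)"
  shows "cadjoint A = B"
  unfolding cadjoint_def
proof (rule the_equality)
  show "\<forall>x y. cinner (A x) y = cinner x (B y)"
    using cinner_adjointI[OF assms] by blast
next
  fix C assume "\<forall>x y. cinner (A x) y = cinner x (C y)"
  then have "inner (A x) y = inner x (C y)" for x y
    by (simp add: Re_cinner[symmetric])
  then have "inner x (C y) = inner x (B y)" for x y by (simp add: assms(2))
  then show "C = B" by (metis ext inner_commute vector_eq_ldot)
qed

text \<open>Riesz representation gives the adjoint pointwise, and uniqueness identifies it with the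
  description in \<open>cadjoint\<close>.\<close>

lemma inner_cadjoint:
  assumes "bounded_clinear A"
  shows "inner (A x) y = inner x (cadjoint A y)"
proof -
  have A: "bounded_linear A" using assms by (simp add: bounded_clinear_def)
  have "\<exists>w. \<forall>x. inner (A x) y = inner x w" for y
  proof (rule functional_factorization)
    show "linear (\<lambda>x. inner (A x) y)"
      using A by (intro bounded_linear.linear bounded_linear_inner_left_comp)
    show "\<bar>inner (A x) y\<bar> \<le> (onorm A * norm y) * norm x" for x
      using Cauchy_Schwarz_ineq2[of "A x" y] mult_right_mono[OF onorm[OF A, of x], of "norm y"]
      by (simp add: mult_ac)
    show "linear (\<lambda>x::'a. x)" by (rule bounded_linear.linear[OF bounded_linear_ident])
  qed
  then obtain B where "\<And>x y. inner (A x) y = inner x (B y)" by metis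
  then show ?thesis using cadjoint_eqI[OF assms, of B] by simp
qed

text \<open>Linearity follows by testing against all vectors; with A' the adjoint, the norm bound is
  ||A' y||^2 = <A A' y, y> \<le> ||A' y|| ||y||.\<close>

lemma contraction_cadjoint:
  assumes "contraction A"
  shows "contraction (cadjoint A)"
proof -
  have bc: "bounded_clinear A" and le: "\<And>x. norm (A x) \<le> norm x"
    using assms by (auto simp: contraction_def)
  note adj = inner_cadjoint[OF bc]
  have nle: "norm (cadjoint A y) \<le> norm y" for y
  proof -
    let ?n = "norm (cadjoint A y)"
    have "?n * ?n = inner (A (cadjoint A y)) y"
      by (simp add: adj dot_square_norm power2_eq_square)
    also have "\<dots> \<le> norm (A (cadjoint A y)) * norm y" by (rule norm_cauchy_schwarz)
    also have "\<dots> \<le> ?n * norm y" by (intro mult_right_mono le) simp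
    finally show ?thesis by (cases "?n = 0") auto
  qed
  have "bounded_linear (cadjoint A)"
  proof (rule bounded_linear_intro[where K = 1])
    show "cadjoint A (x + y) = cadjoint A x + cadjoint A y" for x y
      by (subst vector_eq_ldot[symmetric]) (simp add: inner_simps adj[symmetric])
    show "cadjoint A (r *\<^sub>R x) = r *\<^sub>R cadjoint A x" for r x
      by (subst vector_eq_ldot[symmetric]) (simp add: inner_simps adj[symmetric])
  qed (simp add: nle)
  moreover have "cadjoint A (\<i> *\<^sub>C x) = \<i> *\<^sub>C cadjoint A x" for x
  proof (subst vector_eq_ldot[symmetric], intro allI)
    fix z
    have "inner z (cadjoint A (\<i> *\<^sub>C x)) = inner (A z) (\<i> *\<^sub>C x)" by (simp add: adj)
    also have "\<dots> = - inner (A (\<i> *\<^sub>C z)) x"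
      using bc by (simp add: bounded_clinear_def inner_imaginary_left)
    also have "\<dots> = inner z (\<i> *\<^sub>C cadjoint A x)"
      by (simp add: adj inner_imaginary_left)
    finally show "inner z (cadjoint A (\<i> *\<^sub>C x)) = inner z (\<i> *\<^sub>C cadjoint A x)" .
  qed
  ultimately show ?thesis using nle by (simp add: contraction_def bounded_clinearI)
qed

lemma cadjoint_cadjoint:
  assumes "contraction A"
  shows "cadjoint (cadjoint A) = A"
proof (rule cadjoint_eqI)
  show "bounded_clinear (cadjoint A)"
    using contraction_cadjoint[OF assms] by (simp add: contraction_def)
  show "inner (cadjoint A x) y = inner x (A y)" for x y
    using assms inner_cadjoint[of A y x] by (simp add: contraction_def inner_commute)
qed

section \<open>Positive operators\<close>

text \<open>Complex polarization: since <A x, x> is real, the real bilinear form <i A x, y> vanishes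
  on the diagonal and is therefore alternating.\<close>

lemma positive_op_symmetric:
  assumes "positive_op A"
  shows "inner (A x) y = inner x (A y)"
proof -
  have A: "bounded_linear A" and iA: "\<And>x. A (\<i> *\<^sub>C x) = \<i> *\<^sub>C A x"
    using assms by (auto simp: positive_op_def bounded_clinear_def)
  have zero: "inner (\<i> *\<^sub>C A x) x = 0" for x
  proof -
    have "Im (cinner (A x) x) = 0"
      using assms by (auto simp: positive_op_def complex_nonneg_Reals_iff)
    then show ?thesis by (simp add: cinner_eq)
  qed
  have skew: "inner (\<i> *\<^sub>C A x) y = - inner (\<i> *\<^sub>C A y) x" for x y
    using zero[of "x + y"] zero[of x] zero[of y]
    by (simp add: linear_simps[OF A] scaleC_add_right inner_simps)
  have "inner (A (\<i> *\<^sub>C x)) y = inner (\<i> *\<^sub>C x) (A y)" for x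
    using skew[of x y] inner_imaginary_left[of "A y" x] by (simp add: iA inner_commute)
  \<comment> \<open>The substitution removes the imaginary unit, since i (- i x) = x.\<close>
  from this[of "- (\<i> *\<^sub>C x)"] show ?thesis
    by (simp add: linear_simps[OF bounded_linear_imaginary] imaginary_imaginary)
qed

lemma positive_op_inner_nonneg:
  assumes "positive_op A"
  shows "0 \<le> inner (A x) x"
  using assms by (auto simp: positive_op_def complex_nonneg_Reals_iff Re_cinner)

text \<open>The nonnegative quadratic form of A has a minimum at x, so its derivative 2 <A x, y>
  vanishes in every direction y.\<close>

lemma positive_op_inner_zero:
  assumes "positive_op A" "inner (A x) x = 0"
  shows "A x = 0"
proof -
  have A: "bounded_linear A" using assms by (simp add: positive_op_def bounded_clinear_def)
  have "inner (A x) y = 0" for y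
  proof (rule quadratic_nonneg_imp_linear_zero[where b = "inner (A y) y"])
    fix t :: real
    have "inner (A y) x = inner (A x) y"
      by (subst positive_op_symmetric[OF assms(1)]) (rule inner_commute)
    then show "0 \<le> 2 * t * inner (A x) y + t\<^sup>2 * inner (A y) y"
      using positive_op_inner_nonneg[OF assms(1), of "x + t *\<^sub>R y"] assms(2)
      by (simp add: linear_simps[OF A] inner_simps power2_eq_square algebra_simps)
  qed
  then show ?thesis by (metis inner_eq_zero_iff)
qed

lemma positive_opI:
  assumes "bounded_clinear A" "\<And>x y. inner (A x) y = inner x (A y)" "\<And>x. 0 \<le> inner (A x) x"
  shows "positive_op A"
  unfolding positive_op_def
proof (intro conjI allI)
  fix x
  have "cinner (A x) x = cnj (cinner (A x) x)"
    using cinner_adjointI[OF assms(1,2)] cinner_commute by metis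
  then have "Im (cinner (A x) x) = 0" by (simp add: complex_eq_iff)
  then show "cinner (A x) x \<in> \<real>\<^sub>\<ge>\<^sub>0"
    using assms(3)[of x] by (simp add: complex_nonneg_Reals_iff Re_cinner)
qed (rule assms(1))

text \<open>For y = (B - C) x, commutation gives (B + C) y = 0. Hence the nonnegative numbers <B y,
  y> and <C y, y> vanish, so B y = C y = 0 and ||y||^2 = <x, (B - C) y> = 0.\<close>

lemma commuting_positive_sqrt_unique:
  assumes B: "positive_op B" and C: "positive_op C" and sq: "\<And>x. B (B x) = C (C x)"
    and comm: "\<And>x. C (B x) = B (C x)"
  shows "B = C"
proof
  fix x
  have lin: "bounded_linear B" "bounded_linear C"
    using B C by (auto simp: positive_op_def bounded_clinear_def)
  let ?y = "B x - C x"
  have "B ?y + C ?y = 0"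
    by (simp add: linear_simps[OF lin(1)] linear_simps[OF lin(2)] sq comm)
  then have "inner (B ?y) ?y + inner (C ?y) ?y = 0"
    by (metis inner_add_left inner_zero_left)
  then have "inner (B ?y) ?y = 0" "inner (C ?y) ?y = 0"
    using positive_op_inner_nonneg[OF B, of ?y] positive_op_inner_nonneg[OF C, of ?y] by linarith+
  then have "B ?y = 0" "C ?y = 0"
    using positive_op_inner_zero B C by blast+
  moreover have "inner ?y ?y = inner x (B ?y) - inner x (C ?y)"
    by (simp add: inner_diff_left positive_op_symmetric[OF B] positive_op_symmetric[OF C])
  ultimately show "B x = C x" by simp
qed

section \<open>Square roots of I - T for self-adjoint contractions T\<close>

text \<open>Common setting for the two operators T needed below, \<open>cadjoint Y \<circ> Y\<close>
  and \<open>real_part_op Y\<close>.\<close>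

definition symmetric_contraction :: "('a::chilbert_space \<Rightarrow> 'a) \<Rightarrow> bool"
  where "symmetric_contraction T \<longleftrightarrow>
    contraction T \<and> (\<forall>x y. inner (T x) y = inner x (T y))"

lemma symmetric_contractionD:
  assumes "symmetric_contraction T"
  shows "bounded_linear T" "T (\<i> *\<^sub>C x) = \<i> *\<^sub>C T x" "inner (T x) y = inner x (T y)"
    "norm (Blinfun T) \<le> 1"
proof -
  show T: "bounded_linear T" and "T (\<i> *\<^sub>C x) = \<i> *\<^sub>C T x" and "inner (T x) y = inner x (T y)"
    using assms by (auto simp: symmetric_contraction_def contraction_def bounded_clinear_def)
  show "norm (Blinfun T) \<le> 1"
    using assms
    by (intro norm_blinfun_bound)
      (auto simp: bounded_linear_Blinfun_apply[OF T] symmetric_contraction_def contraction_def)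
qed

text \<open>Any positive root C of I - T commutes with T = I - C^2, hence with the root built by
  iteration, and uniqueness among commuting positive roots applies.\<close>

lemma sqrt_op_eq:
  assumes T: "symmetric_contraction T"
  shows "positive_op (sqrt_one_minus (Blinfun T))"
    and "sqrt_op (id - T) = sqrt_one_minus (Blinfun T)"
proof -
  note T_props = symmetric_contractionD[OF T]
  note ap = bounded_linear_Blinfun_apply[OF T_props(1)]
  let ?B = "sqrt_one_minus (Blinfun T)"
  show pos: "positive_op ?B"
  proof (rule positive_opI)
    \<comment> \<open>Complex linearity is the intertwining property for multiplication by the
      imaginary unit.\<close>
    have "\<i> *\<^sub>C ?B x = ?B (\<i> *\<^sub>C x)" for x
      by (rule sqrt_one_minus_intertwine)
        (simp_all add: T_props bounded_linear_imaginary ap)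
    then show "bounded_clinear ?B"
      by (intro bounded_clinearI bounded_linear_sqrt_one_minus) simp
    show "inner (?B x) y = inner x (?B y)" for x y
      by (simp add: inner_sqrt_one_minus_commute T_props ap)
  qed (simp add: inner_sqrt_one_minus_nonneg T_props)
  have sq: "?B (?B x) = x - T x" for x
    by (simp add: sqrt_one_minus_squared T_props ap)
  show "sqrt_op (id - T) = ?B"
    unfolding sqrt_op_def
  proof (rule the_equality)
    show "positive_op ?B \<and> ?B \<circ> ?B = id - T"
      using pos sq by (auto simp: fun_eq_iff)
  next
    fix C assume C: "positive_op C \<and> C \<circ> C = id - T"
    then have CC: "C (C x) = x - T x" for x by (metis comp_apply fun_diff_def id_apply)
    have lin: "bounded_linear C" using C by (simp add: positive_op_def bounded_clinear_def)
    have "T x = x - C (C x)" for x by (simp add: CC)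
    then have "C (T x) = T (C x)" for x by (simp add: linear_simps[OF lin])
    then have "C (?B x) = ?B (C x)" for x
      by (intro sqrt_one_minus_intertwine) (simp_all add: T_props lin ap)
    then show "C = ?B"
      using commuting_positive_sqrt_unique[OF pos, of C] C by (simp add: sq CC)
  qed
qed

text \<open>Together with \<open>sqrt_op_intertwine\<close>, all that the later arguments use about
  the square root.\<close>

lemma sqrt_op_props:
  assumes "symmetric_contraction T"
  shows "linear (sqrt_op (id - T))"
    and "inner (sqrt_op (id - T) x) y = inner x (sqrt_op (id - T) y)"
    and "sqrt_op (id - T) (sqrt_op (id - T) x) = x - T x"
    and "(norm (sqrt_op (id - T) x))\<^sup>2 = inner x x - inner (T x) x"
proof -
  let ?S = "sqrt_op (id - T)"
  show "linear ?S"
    by (simp add: sqrt_op_eq[OF assms] bounded_linear.linear bounded_linear_sqrt_one_minus)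
  show sym: "inner (?S x) y = inner x (?S y)" for x y
    using positive_op_symmetric[OF sqrt_op_eq(1)[OF assms]] by (simp add: sqrt_op_eq[OF assms])
  show sq: "?S (?S x) = x - T x" for x
    using symmetric_contractionD[OF assms]
    by (simp add: sqrt_op_eq[OF assms] sqrt_one_minus_squared bounded_linear_Blinfun_apply)
  show "(norm (?S x))\<^sup>2 = inner x x - inner (T x) x"
    by (simp add: power2_norm_eq_inner sym sq inner_simps inner_commute)
qed

lemma sqrt_op_intertwine:
  assumes "symmetric_contraction T" "symmetric_contraction T'" "bounded_linear Z"
    and "\<And>x. Z (T x) = T' (Z x)"
  shows "Z (sqrt_op (id - T) x) = sqrt_op (id - T') (Z x)"
  using assms(4) symmetric_contractionD[OF assms(1)] symmetric_contractionD[OF assms(2)]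
  by (simp add: sqrt_op_eq assms(1,2) sqrt_one_minus_intertwine[OF _ _ assms(3)]
      bounded_linear_Blinfun_apply)

section \<open>Defect operators\<close>

lemma symmetric_contraction_adjoint_comp:
  assumes "contraction Y"
  shows "symmetric_contraction (cadjoint Y \<circ> Y)"
proof -
  have Y: "bounded_linear Y" "bounded_clinear Y" "\<And>c x. Y (c *\<^sub>C x) = c *\<^sub>C Y x"
      "\<And>x. norm (Y x) \<le> norm x"
    using assms by (auto simp: contraction_def bounded_clinear_def)
  have Y': "bounded_linear (cadjoint Y)" "\<And>c x. cadjoint Y (c *\<^sub>C x) = c *\<^sub>C cadjoint Y x"
      "\<And>x. norm (cadjoint Y x) \<le> norm x"
    using contraction_cadjoint[OF assms] by (auto simp: contraction_def bounded_clinear_def)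
  have "inner (cadjoint Y (Y x)) y = inner x (cadjoint Y (Y y))" for x y
    by (metis inner_cadjoint[OF Y(2)] inner_commute)
  moreover have "norm (cadjoint Y (Y x)) \<le> norm x" for x
    using Y(4) Y'(3) order_trans by blast
  ultimately show ?thesis
    using Y Y' by (auto simp: symmetric_contraction_def contraction_def bounded_clinear_def o_def
        intro: bounded_linear_compose)
qed

lemma symmetric_contraction_real_part:
  assumes "contraction Y"
  shows "symmetric_contraction (real_part_op Y)"
proof -
  have Y: "bounded_linear Y" "bounded_clinear Y" "\<And>c x. Y (c *\<^sub>C x) = c *\<^sub>C Y x"
      "\<And>x. norm (Y x) \<le> norm x"
    using assms by (auto simp: contraction_def bounded_clinear_def)
  have Y': "bounded_linear (cadjoint Y)" "\<And>c x. cadjoint Y (c *\<^sub>C x) = c *\<^sub>C cadjoint Y x"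
      "\<And>x. norm (cadjoint Y x) \<le> norm x"
    using contraction_cadjoint[OF assms] by (auto simp: contraction_def bounded_clinear_def)
  have "bounded_linear (real_part_op Y)"
    unfolding real_part_op_def
    by (intro bounded_linear_compose[OF bounded_linear_scaleR_right] bounded_linear_add Y Y')
  then have "bounded_clinear (real_part_op Y)"
    by (rule bounded_clinearI)
      (simp add: real_part_op_def Y Y' linear_simps[OF bounded_linear_imaginary])
  moreover have "norm (real_part_op Y x) \<le> norm x" for x
    using norm_triangle_ineq[of "Y x" "cadjoint Y x"] Y(4)[of x] Y'(3)[of x]
    by (simp add: real_part_op_def)
  moreover have "inner (real_part_op Y x) y = inner x (real_part_op Y y)" for x y
  proof -
    have "inner (cadjoint Y x) y = inner x (Y y)"
      by (metis inner_cadjoint[OF Y(2)] inner_commute)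
    then show ?thesis by (simp add: real_part_op_def inner_simps inner_cadjoint[OF Y(2)])
  qed
  ultimately show ?thesis by (simp add: symmetric_contraction_def contraction_def)
qed

lemma defect_props:
  assumes "contraction Y"
  shows "linear (defect Y)"
    and "inner (defect Y x) y = inner x (defect Y y)"
    and "defect Y (defect Y x) = x - cadjoint Y (Y x)"
    and "(norm (defect Y x))\<^sup>2 = (norm x)\<^sup>2 - (norm (Y x))\<^sup>2"
proof -
  note props = sqrt_op_props[OF symmetric_contraction_adjoint_comp[OF assms]]
  show "linear (defect Y)" "inner (defect Y x) y = inner x (defect Y y)"
      "defect Y (defect Y x) = x - cadjoint Y (Y x)"
    using props by (simp_all add: defect_def)
  have "inner (cadjoint Y (Y x)) x = inner (Y x) (Y x)"
    using assms by (metis contraction_def inner_cadjoint inner_commute)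
  then show "(norm (defect Y x))\<^sup>2 = (norm x)\<^sup>2 - (norm (Y x))\<^sup>2"
    unfolding defect_def props(4) by (simp add: power2_norm_eq_inner)
qed

text \<open>With Y' the adjoint, Y (Y' Y) = (Y Y') Y, and this relation passes to the square
  roots.\<close>

lemma defect_intertwine:
  assumes "contraction Y"
  shows "Y (defect Y x) = defect (cadjoint Y) (Y x)"
  unfolding defect_def
proof (rule sqrt_op_intertwine)
  show "symmetric_contraction (cadjoint (cadjoint Y) \<circ> cadjoint Y)"
    by (intro symmetric_contraction_adjoint_comp contraction_cadjoint assms)
  show "bounded_linear Y" using assms by (simp add: contraction_def bounded_clinear_def)
  show "symmetric_contraction (cadjoint Y \<circ> Y)"
    by (rule symmetric_contraction_adjoint_comp[OF assms])
qed (simp add: assms cadjoint_cadjoint)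

text \<open>Since <Y x, x> = ||x||^2 and ||Y x|| \<le> ||x||, expanding ||Y x - x||^2 gives at most
  0.\<close>

lemma cadjoint_fixed_imp_fixed:
  assumes "contraction Y" "cadjoint Y x = x"
  shows "Y x = x"
proof -
  have Y: "bounded_clinear Y" "norm (Y x) \<le> norm x" using assms by (auto simp: contraction_def)
  have "inner (Y x) x = inner x x" by (simp add: inner_cadjoint[OF Y(1)] assms(2))
  moreover have "inner (Y x) (Y x) \<le> inner x x" using Y(2) by (simp add: norm_le)
  ultimately have "inner (Y x - x) (Y x - x) \<le> 0" by (simp add: inner_simps inner_commute)
  then show ?thesis by (metis eq_iff_diff_eq_0 inner_ge_zero inner_eq_zero_iff order_antisym)
qed

text \<open>Makes the kernel assumption symmetric, so that results for Y can also be applied to its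
  adjoint.\<close>

lemma inj_one_minus_cadjoint:
  assumes Y: "contraction Y" and inj: "inj (id - Y)"
  shows "inj (id - cadjoint Y)"
proof (rule injI)
  fix x y assume eq: "(id - cadjoint Y) x = (id - cadjoint Y) y"
  have lin: "bounded_linear Y" "bounded_linear (cadjoint Y)"
    using Y contraction_cadjoint[OF Y] by (auto simp: contraction_def bounded_clinear_def)
  have "cadjoint Y (x - y) = x - y"
    using eq by (simp add: linear_simps[OF lin(2)] algebra_simps)
  then have "Y (x - y) = x - y" by (rule cadjoint_fixed_imp_fixed[OF Y])
  then have "(id - Y) x = (id - Y) y" by (simp add: linear_simps[OF lin(1)] algebra_simps)
  then show "x = y" by (rule injD[OF inj])
qed

section \<open>The range of the square root of I minus the real part\<close>

lemma range_defect_sum: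
  assumes "contraction Y"
  shows "range (defect (cadjoint Y)) + range (id - Y) = range (sqrt_op (id - real_part_op Y))"
proof -
  have Y: "bounded_clinear Y" "contraction (cadjoint Y)" "bounded_linear (cadjoint Y)"
    using assms contraction_cadjoint[OF assms] by (auto simp: contraction_def bounded_clinear_def)
  note E = defect_props[OF Y(2)]
  note S = sqrt_op_props[OF symmetric_contraction_real_part[OF assms]]
  show ?thesis
  \<comment> \<open>With Y' the adjoint and E its defect operator, the terms ||Y' x||^2 cancel in
    ||E x||^2 + ||x - Y' x||^2, leaving 2 (||x||^2 - <Y' x, x>); hence k = 2.\<close>
  proof (rule range_sum_eq[where k = 2 and A' = "defect (cadjoint Y)" and B' = "id - cadjoint Y"])
    show "linear (id - cadjoint Y)"
      using Y(3) by (intro linearI) (simp_all add: linear_simps[OF Y(3)] algebra_simps)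
    have adj: "inner (cadjoint Y x) y = inner x (Y y)" for x y
      by (metis inner_cadjoint[OF Y(1)] inner_commute)
    then show "inner ((id - cadjoint Y) x) y = inner x ((id - Y) y)" for x y
      by (simp add: inner_simps)
    have adj': "inner x (cadjoint Y x) = inner x (Y x)" for x
      by (metis adj inner_commute)
    show "(norm (defect (cadjoint Y) x))\<^sup>2 + (norm ((id - cadjoint Y) x))\<^sup>2
        = 2 * (norm (sqrt_op (id - real_part_op Y) x))\<^sup>2" for x
      unfolding E(4) S(4)
      by (simp add: real_part_op_def power2_norm_eq_inner inner_simps adj adj' inner_commute[of "Y x"])
  qed (simp_all add: E(1,2) S(1,2))
qed

section \<open>The conjugate vector and intersections of ranges\<close>

text \<open>Here f is a preimage under I - Y of the defect vector. With Y' the adjoint, intertwining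
  turns the left side into - Y' (f - Y f) + (f - Y' Y f).\<close>

lemma defect_of_conjugate:
  assumes Y: "contraction Y" and eq: "defect (cadjoint Y) h = f - Y f"
  shows "defect Y (- cadjoint Y h + defect Y f) = f - cadjoint Y f"
proof -
  note D = defect_props[OF Y]
  have lin: "bounded_linear (cadjoint Y)"
    using contraction_cadjoint[OF Y] by (simp add: contraction_def bounded_clinear_def)
  have "defect Y (cadjoint Y h) = cadjoint Y (defect (cadjoint Y) h)"
    using defect_intertwine[OF contraction_cadjoint[OF Y]] by (simp add: cadjoint_cadjoint Y)
  then show ?thesis
    by (simp add: linear_add[OF D(1)] linear_neg[OF D(1)] linear_diff[OF D(1)] D(3) eq linear_simps[OF lin])
qed

text \<open>After expansion the claim becomes ||f||^2 = ||f - Y f||^2 + 2 <f - Y f, Y f> + ||Y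
  f||^2, the square of f = (f - Y f) + Y f.\<close>

lemma norm_of_conjugate:
  assumes Y: "contraction Y" and eq: "defect (cadjoint Y) h = f - Y f"
  shows "norm (- cadjoint Y h + defect Y f) = norm h"
proof -
  have Y': "contraction (cadjoint Y)" and bc: "bounded_clinear Y"
    using contraction_cadjoint[OF Y] Y by (auto simp: contraction_def)
  have "inner (cadjoint Y h) (defect Y f) = inner h (Y (defect Y f))"
    by (metis inner_cadjoint[OF bc] inner_commute)
  also have "\<dots> = inner (f - Y f) (Y f)"
    by (simp add: defect_intertwine[OF Y] defect_props(2)[OF Y', symmetric] eq)
  finally have cross: "inner (cadjoint Y h) (defect Y f) = inner (f - Y f) (Y f)" .
  have "(norm (cadjoint Y h))\<^sup>2 = (norm h)\<^sup>2 - (norm (f - Y f))\<^sup>2"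
    using defect_props(4)[OF Y', of h] by (simp add: eq)
  then have "(norm (- cadjoint Y h + defect Y f))\<^sup>2 = (norm h)\<^sup>2"
    using defect_props(4)[OF Y, of f] cross
    by (simp add: power2_norm_eq_inner inner_simps inner_commute)
  then show ?thesis by simp
qed

text \<open>One vector f serves both sides: \<open>(id - cadjoint Y) f\<close> lies in the range of
  \<open>defect Y\<close> exactly when \<open>(id - Y) f\<close> lies in that of
  \<open>defect (cadjoint Y)\<close>. The map \<open>inv (id - Y)\<close> is applied only on the
  range, where it is the true inverse.\<close>

lemma range_Int_range_defect:
  assumes Y: "contraction Y" and inj: "inj (id - Y)"
  shows "range (id - cadjoint Y) \<inter> range (defect Y) =
      ((id - cadjoint Y) \<circ> inv (id - Y)) ` (range (id - Y) \<inter> range (defect (cadjoint Y)))"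
    (is "?L = ?R")
proof
  show "?L \<subseteq> ?R"
  proof
    fix z assume "z \<in> ?L"
    then obtain f g where "z = (id - cadjoint Y) f" and g: "z = defect Y g" by blast
    then have z: "z = f - cadjoint Y f" "z = defect Y g" by simp_all
    \<comment> \<open>The conjugate-vector identity for the adjoint, with g in the role of
      h.\<close>
    have "defect (cadjoint Y) (- Y g + defect (cadjoint Y) f) = f - Y f"
      using defect_of_conjugate[OF contraction_cadjoint[OF Y], of g f] z
      by (simp add: cadjoint_cadjoint[OF Y])
    then have "(id - Y) f \<in> range (id - Y) \<inter> range (defect (cadjoint Y))"
      by (metis IntI fun_diff_def id_apply rangeI)
    moreover have "z = ((id - cadjoint Y) \<circ> inv (id - Y)) ((id - Y) f)"
      using inv_f_f[OF inj, of f] z by simp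
    ultimately show "z \<in> ?R" by blast
  qed
  show "?R \<subseteq> ?L"
  proof
    fix z assume "z \<in> ?R"
    then obtain f h where f: "(id - Y) f = defect (cadjoint Y) h"
        and z: "z = (id - cadjoint Y) (inv (id - Y) ((id - Y) f))" by auto
    then have z': "z = f - cadjoint Y f" using inv_f_f[OF inj, of f] by simp
    have "z = defect Y (- cadjoint Y h + defect Y f)"
      using defect_of_conjugate[OF Y, of h f] f z' by simp
    then show "z \<in> ?L" using z by blast
  qed
qed

text \<open>The map between the two intersections sends 0 to 0.\<close>

lemma range_Int_range_defect_trivial:
  assumes Y: "contraction Y" and inj: "inj (id - Y)"
    and "range (id - Y) \<inter> range (defect (cadjoint Y)) = {0}"
  shows "range (id - cadjoint Y) \<inter> range (defect Y) = {0}"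
proof -
  have lin: "bounded_linear Y" "bounded_linear (cadjoint Y)"
    using Y contraction_cadjoint[OF Y] by (auto simp: contraction_def bounded_clinear_def)
  have "inv (id - Y) 0 = 0"
    using inv_f_f[OF inj, of 0] by (simp add: linear_simps[OF lin(1)])
  then show ?thesis
    unfolding range_Int_range_defect[OF Y inj] assms(3) by (simp add: linear_simps[OF lin(2)])
qed

section \<open>Inclusions between ranges\<close>

lemma range_sum_absorb:
  assumes "linear A" "linear B" and "range A + range B = R"
  shows "range A \<subseteq> R" "range B \<subseteq> R" "range A \<subseteq> range B \<longleftrightarrow> range B = R"
proof -
  have "A x = A x + B 0" "B y = A 0 + B y" for x y
    using assms by (simp_all add: linear_0)
  then show AR: "range A \<subseteq> R" and BR: "range B \<subseteq> R"
    using assms(3) unfolding set_plus_def by blast+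
  have sub: "subspace (range B)" by (rule linear_subspace_image[OF assms(2) subspace_UNIV])
  have "R \<subseteq> range B" if "range A \<subseteq> range B"
  proof
    fix z assume "z \<in> R"
    then obtain a b where "z = a + b" "a \<in> range A" "b \<in> range B"
      unfolding assms(3)[symmetric] by (rule set_plus_elim)
    then show "z \<in> range B" using that subspace_add[OF sub] by blast
  qed
  then show "range A \<subseteq> range B \<longleftrightarrow> range B = R" using AR BR by blast
qed

lemma range_defect_squared_iff:
  assumes Y: "contraction Y"
  shows "range (defect Y ^^ 2) \<subseteq> range (id - cadjoint Y) \<longleftrightarrow>
    range (id - Y) \<subseteq> range (id - cadjoint Y)"
proof -
  have lin: "bounded_linear (cadjoint Y)"
    using contraction_cadjoint[OF Y] by (auto simp: contraction_def bounded_clinear_def)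
  have "linear (id - cadjoint Y)"
    by (intro linearI) (simp_all add: linear_simps[OF lin] algebra_simps)
  then have sub: "subspace (range (id - cadjoint Y))"
    by (rule linear_subspace_image[OF _ subspace_UNIV])
  have "(defect Y ^^ 2) x = (id - cadjoint Y) (Y x) + (id - Y) x" for x
    by (simp add: numeral_2_eq_2 defect_props(3)[OF Y])
  \<comment> \<open>The two vectors differ by an element of the subspace, so they belong to it
    together.\<close>
  then have "(defect Y ^^ 2) x \<in> range (id - cadjoint Y) \<longleftrightarrow> (id - Y) x \<in> range (id - cadjoint Y)"
    for x
    using subspace_add[OF sub] subspace_diff[OF sub] by (metis add_diff_cancel_left' rangeI)
  then show ?thesis by blast
qed

theorem theorem4p1:
  fixes Y :: "'a::chilbert_space \<Rightarrow> 'a"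
  assumes "contraction Y"
    and "{x. (id - Y) x = 0} = {0}"
  shows
    "(range (defect (cadjoint Y)) + range (id - Y) = range (defect Y) + range (id - cadjoint Y) \<and>
      range (defect Y) + range (id - cadjoint Y) = range (sqrt_op (id - real_part_op Y)) \<and>
      range (id - Y) \<subseteq> range (sqrt_op (id - real_part_op Y)) \<and>
      range (id - cadjoint Y) \<subseteq> range (sqrt_op (id - real_part_op Y)) \<and>
      range (defect Y) \<subseteq> range (sqrt_op (id - real_part_op Y)) \<and>
      range (defect (cadjoint Y)) \<subseteq> range (sqrt_op (id - real_part_op Y)))
     \<and>
     (range (id - Y) \<inter> range (defect (cadjoint Y)) = {0} \<longleftrightarrow>
      range (id - cadjoint Y) \<inter> range (defect Y) = {0})
     \<and>
     (range (id - cadjoint Y) \<inter> range (defect Y) =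
      ((id - cadjoint Y) \<circ> inv (id - Y)) ` (range (id - Y) \<inter> range (defect (cadjoint Y))))
     \<and>
     (\<forall>h. defect (cadjoint Y) h \<in> range (id - Y) \<longrightarrow>
        norm (- cadjoint Y h + defect Y (inv (id - Y) (defect (cadjoint Y) h))) = norm h \<and>
        defect Y (- cadjoint Y h + defect Y (inv (id - Y) (defect (cadjoint Y) h)))
          \<in> range (id - cadjoint Y))
     \<and>
     (range (defect (cadjoint Y)) \<subseteq> range (id - Y) \<longleftrightarrow>
      range (id - Y) = range (sqrt_op (id - real_part_op Y)))
     \<and>
     (range (defect Y) \<subseteq> range (id - cadjoint Y) \<longleftrightarrow>
      range (id - cadjoint Y) = range (sqrt_op (id - real_part_op Y)))
     \<and>
     (range (defect (cadjoint Y)) \<subseteq> range (id - Y) \<and>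
      range (defect Y) \<subseteq> range (id - cadjoint Y) \<longleftrightarrow>
      range (id - cadjoint Y) = range (id - Y) \<and>
      range (id - Y) = range (sqrt_op (id - real_part_op Y)))
     \<and>
     (range (defect Y ^^ 2) \<subseteq> range (id - cadjoint Y) \<longleftrightarrow>
      range (id - Y) \<subseteq> range (id - cadjoint Y))"
proof -
  let ?D = "defect Y" and ?E = "defect (cadjoint Y)"
  let ?A = "id - Y" and ?A' = "id - cadjoint Y" and ?S = "sqrt_op (id - real_part_op Y)"
  note Y = assms(1)
  note Y' = contraction_cadjoint[OF Y]
  have blin: "bounded_linear Y" "bounded_linear (cadjoint Y)"
    using Y Y' by (auto simp: contraction_def bounded_clinear_def)
  have lin: "linear ?A" "linear ?A'"
    by (intro linearI; simp add: linear_simps[OF blin(1)] linear_simps[OF blin(2)] algebra_simps)+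
  have inj: "inj ?A"
    using assms(2) by (auto simp: linear_injective_0[OF lin(1)])
  have inj': "inj ?A'" by (rule inj_one_minus_cadjoint[OF Y inj])
  have sum: "range ?E + range ?A = range ?S" by (rule range_defect_sum[OF Y])
  \<comment> \<open>Y and its adjoint have the same real part, so both sums of ranges have the same
    value.\<close>
  have "real_part_op (cadjoint Y) = real_part_op Y"
    by (simp add: real_part_op_def cadjoint_cadjoint[OF Y] add.commute)
  then have sum': "range ?D + range ?A' = range ?S"
    using range_defect_sum[OF Y'] by (simp add: cadjoint_cadjoint[OF Y])
  note R = range_sum_absorb[OF defect_props(1)[OF Y'] lin(1) sum]
  note R' = range_sum_absorb[OF defect_props(1)[OF Y] lin(2) sum']
  have 2: "range ?A \<inter> range ?E = {0} \<longleftrightarrow> range ?A' \<inter> range ?D = {0}"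
    \<comment> \<open>The converse is the same implication for the adjoint, whose adjoint is
      Y.\<close>
    using range_Int_range_defect_trivial[OF Y inj] range_Int_range_defect_trivial[OF Y' inj']
    by (auto simp: cadjoint_cadjoint[OF Y])
  have 4: "norm (- cadjoint Y h + ?D (inv ?A (?E h))) = norm h \<and>
      ?D (- cadjoint Y h + ?D (inv ?A (?E h))) \<in> range ?A'" if "?E h \<in> range ?A" for h
  proof -
    \<comment> \<open>Membership in the range makes \<open>inv ?A (?E h)\<close> a genuine preimage,
      which serves as f.\<close>
    have eq: "?E h = inv ?A (?E h) - Y (inv ?A (?E h))"
      using f_inv_into_f[OF that] by simp
    have "?D (- cadjoint Y h + ?D (inv ?A (?E h))) = ?A' (inv ?A (?E h))"
      using defect_of_conjugate[OF Y eq] by simp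
    then show ?thesis using norm_of_conjugate[OF Y eq] by blast
  qed
  show ?thesis
  proof (intro conjI)
    show "range ?E + range ?A = range ?D + range ?A'" by (simp only: sum sum')
    show "range ?E \<subseteq> range ?A \<and> range ?D \<subseteq> range ?A' \<longleftrightarrow>
        range ?A' = range ?A \<and> range ?A = range ?S"
      unfolding R(3) R'(3) by metis
    show "\<forall>h. ?E h \<in> range ?A \<longrightarrow>
        norm (- cadjoint Y h + ?D (inv ?A (?E h))) = norm h \<and>
        ?D (- cadjoint Y h + ?D (inv ?A (?E h))) \<in> range ?A'"
      using 4 by blast
  qed (fact sum' R R' 2 range_Int_range_defect[OF Y inj] range_defect_squared_iff[OF Y])+
qed

end
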